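(* There exists a bijection $f:[0,1]\rightarrow[0,1]$ such that the set $$S=\bigcup_{t\in[0,1]}\bigcup_{x\in[0,1]}\{((1-t)x+tf(x),\,t)\}\subset\mathbb{R}^2$$ satisfies $\mu(S)=0$.
   Context: $\mu$ denotes two-dimensional Lebesgue measure on $\mathbb{R}^2$. *)

theory Defs
  imports "HOL-Analysis.Analysis"
begin

end

theory Submission imports Defs begin

text \<open>
  Write \<open>x\<close> in a mixed radix system with radices \<open>N 0, N 1, \<dots>\<close> and let \<open>f\<close> act on the digits,
  sending the \<open>n\<close>-th digit \<open>a\<close> to \<open>s n a\<close> for a permutation \<open>s n\<close> of \<open>{..<N n}\<close>.  Apart from countably
  many \<open>x\<close>, whose segments form a null set, this is a well-defined bijection.  Fixing the first
  \<open>n + 1\<close> digits of \<open>x\<close> confines the segment from \<open>(x, 0)\<close> to \<open>(f x, 1)\<close> to a strip whose horizontal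
  width is the size of a cell, so the union of the segments lies in a finite union of strips.
  At height \<open>t\<close>, the strips that share their first \<open>n\<close> digits form a translate of a
  scaled copy of the unit intervals at the points \<open>(1 - t) a + t s n a\<close> with \<open>a < N n\<close>.  There are as many
  translates as there are cells of level \<open>n\<close>; hence, if those \<open>N n\<close> unit intervals overlap so much
  that their union has measure at most \<open>\<delta> N n\<close>, then the whole slice at height \<open>t\<close> has measure at
  most \<open>\<delta>\<close>, whatever the other levels do (\<open>slice_strips_le\<close>).

  It remains to find, for every \<open>t\<close> strictly between 0 and 1 and every \<open>\<delta> > 0\<close>, a permutation
  with such overlaps (\<open>compressing_permutation\<close>).  By Dirichlet's theorem there are
  positive integers \<open>p\<close> and \<open>q\<close> with \<open>(1 - t) p - t q\<close> close to 0.  A permutation that advances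
  by \<open>- q\<close> whenever its argument advances by \<open>p\<close>, on \<open>p q\<close> long progressions, keeps
  \<open>(1 - t) a + t s a\<close> almost constant on each progression.  Finite permutations are
  countable, so a single sequence of levels contains all of them.  Every slice at a height
  strictly between 0 and 1 is then null, and Fubini's theorem finishes the proof.
\<close>

section \<open>Permutations that compress a slice\<close>

lemma two_digit_eqD:
  fixes i j i' j' n :: nat
  assumes "i * n + j = i' * n + j'" "j < n" "j' < n"
  shows "i = i' \<and> j = j'"
proof -
  have "(i * n + j) div n = i" "(i' * n + j') div n = i'"
    "(i * n + j) mod n = j" "(i' * n + j') mod n = j'" using assms(2,3) by simp_all
  then show ?thesis using assms(1) by metis
qed

lemma two_digit_less:
  fixes i j m n :: nat
  assumes "i < m" "j < n"
  shows "i * n + j < m * n"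
proof -
  have "i * n + j < Suc i * n" using assms by simp
  also have "\<dots> \<le> m * n" using assms by (intro mult_le_mono1) simp
  finally show ?thesis .
qed

text \<open>Two numberings of one finite set compose to a permutation of the numbers.  A permutation
  given by rearranging digits is thereby obtained from its two digit formulas alone.\<close>

lemma permutation_from_bijections:
  fixes \<alpha> \<beta> :: "'a \<Rightarrow> nat"
  assumes "bij_betw \<alpha> T {..<N}" "bij_betw \<beta> T {..<N}"
  obtains s where "s permutes {..<N}" "\<And>x. x \<in> T \<Longrightarrow> s (\<alpha> x) = \<beta> x"
proof
  define s where "s a = (if a < N then \<beta> (inv_into T \<alpha> a) else a)" for a
  have "bij_betw (\<beta> \<circ> inv_into T \<alpha>) {..<N} {..<N}"
    using bij_betw_trans[OF bij_betw_inv_into[OF assms(1)] assms(2)] .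
  then have "bij_betw s {..<N} {..<N}"
    by (rule iffD1[OF bij_betw_cong, rotated]) (simp add: s_def)
  then show "s permutes {..<N}"
    by (rule bij_imp_permutes) (simp add: s_def)
  show "s (\<alpha> x) = \<beta> x" if "x \<in> T" for x
    using that assms(1) bij_betwE[OF assms(1)] by (auto simp: s_def bij_betw_inv_into_left)
qed

text \<open>Since \<open>(1 - t) p - t q = p - t (p + q)\<close>, Dirichlet's theorem supplies \<open>p\<close> as a numerator and
  \<open>p + q\<close> as a denominator.  An error below \<open>t\<close> and below \<open>1 - t\<close> forces both \<open>p\<close> and \<open>q\<close> to be
  positive.\<close>

lemma approximation_in_unit_interval:
  fixes t \<delta> :: real
  assumes t: "0 < t" "t < 1" and \<delta>: "0 < \<delta>"
  obtains p q :: nat where "0 < p" "0 < q" "\<bar>(1 - t) * p - t * q\<bar> < \<delta>"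
proof -
  define \<epsilon> where "\<epsilon> = min \<delta> (min t (1 - t))"
  have \<epsilon>: "\<epsilon> > 0" "\<epsilon> \<le> \<delta>" "\<epsilon> \<le> t" "\<epsilon> \<le> 1 - t" using assms by (auto simp: \<epsilon>_def)
  obtain m :: nat where m: "m > 0" "1 / m < \<epsilon>"
    using reals_Archimedean[OF \<epsilon>(1)] by (metis inverse_eq_divide zero_less_Suc)
  obtain h k where hk: "0 < k" "\<bar>of_int k * t - of_int h\<bar> < 1 / m"
    using Dirichlet_approx[OF m(1), of t] by blast
  have k1: "real_of_int k \<ge> 1" using hk by simp
  have close: "\<bar>of_int k * t - of_int h\<bar> < \<epsilon>" using hk m by linarith
  have "real_of_int k * t \<ge> 1 * t" using k1 t by (intro mult_right_mono) auto
  then have "real_of_int h > 0" using close \<epsilon> by linarith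
  then have h: "h > 0" by simp
  have "real_of_int k * (1 - t) \<ge> 1 * (1 - t)" using k1 t by (intro mult_right_mono) auto
  then have "real_of_int k - of_int h > 0" using close \<epsilon> by (simp add: algebra_simps)
  then have q: "k - h > 0" by simp
  show thesis
  proof (rule that[of "nat h" "nat (k - h)"])
    have "(1 - t) * real (nat h) - t * real (nat (k - h)) = - (of_int k * t - of_int h)"
      using h q by (simp add: algebra_simps)
    then show "\<bar>(1 - t) * real (nat h) - t * real (nat (k - h))\<bar> < \<delta>"
      using close \<epsilon> by linarith
  qed (use h q in auto)
qed

text \<open>
  Put \<open>N = p q M\<close>, write \<open>a = i M p + k p + r\<close> with \<open>i < q\<close>, \<open>k < M\<close>, \<open>r < p\<close>, and let
  \<open>s a = r M q + (M - 1 - k) q + i\<close>.  For fixed \<open>i\<close> and \<open>r\<close>, the value \<open>(1 - t) a + t s a\<close> is an affine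
  function of \<open>k\<close> with the small slope \<open>\<theta> = (1 - t) p - t q\<close>.  The corresponding \<open>M\<close> unit intervals thus lie in
  an interval of length \<open>M \<bar>\<theta>\<bar> + 1\<close>, and the \<open>p q\<close> intervals arising in this way have total
  length \<open>N (\<bar>\<theta>\<bar> + 1 / M)\<close>.
\<close>

lemma compressing_permutation:
  fixes t \<delta> :: real
  assumes t: "0 < t" "t < 1" and \<delta>: "0 < \<delta>"
  obtains N :: nat and s F L where "2 \<le> N" "s permutes {..<N}" "finite F" "0 \<le> L"
    "real (card F) * L \<le> \<delta> * N"
    "\<And>a. a < N \<Longrightarrow> \<exists>c\<in>F. c \<le> (1 - t) * a + t * s a \<and> (1 - t) * a + t * s a + 1 \<le> c + L"
proof -
  obtain p q :: nat where pq: "0 < p" "0 < q" "\<bar>(1 - t) * p - t * q\<bar> < \<delta> / 2"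
    using approximation_in_unit_interval[OF t, of "\<delta> / 2"] \<delta> by auto
  define \<theta> where "\<theta> = (1 - t) * p - t * q"
  obtain M :: nat where M: "M \<ge> 2" "1 / M < \<delta> / 2"
  proof -
    obtain n where n: "inverse (real (Suc n)) < \<delta> / 2"
      using reals_Archimedean[of "\<delta> / 2"] \<delta> by auto
    have "1 / real (Suc (Suc n)) \<le> inverse (real (Suc n))" by (simp add: field_simps)
    with n show ?thesis by (intro that[of "Suc (Suc n)"]) auto
  qed
  define N where "N = p * q * M"
  define T where "T = {..<q} \<times> {..<M} \<times> {..<p}"
  define \<alpha> where "\<alpha> = (\<lambda>(i, k, r). i * (M * p) + (k * p + r))"
  define \<beta> where "\<beta> = (\<lambda>(i, k, r). r * (M * q) + ((M - 1 - k) * q + i))"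
  have card: "card T = N" by (simp add: T_def N_def)
  have \<alpha>: "bij_betw \<alpha> T {..<N}"
  proof (rule bij_betw_imageI)
    show inj: "inj_on \<alpha> T"
    proof (rule inj_onI, clarsimp simp: T_def \<alpha>_def, goal_cases)
      case (1 i k r i' k' r')
      have "i = i' \<and> k * p + r = k' * p + r'"
        by (rule two_digit_eqD[OF 1(1)]) (use 1 in \<open>auto intro: two_digit_less\<close>)
      then show ?case using two_digit_eqD[of k p r k' r'] 1 by auto
    qed
    have "\<alpha> ` T \<subseteq> {..<N}"
    proof (clarsimp simp: T_def \<alpha>_def)
      fix i k r assume "i < q" "k < M" "r < p"
      then have "i * (M * p) + (k * p + r) < q * (M * p)" by (intro two_digit_less) auto
      then show "i * (M * p) + (k * p + r) < N" by (simp add: N_def algebra_simps)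
    qed
    then show "\<alpha> ` T = {..<N}"
      by (intro card_subset_eq) (auto simp: card_image[OF inj] card)
  qed
  have \<beta>: "bij_betw \<beta> T {..<N}"
  proof (rule bij_betw_imageI)
    show inj: "inj_on \<beta> T"
    proof (rule inj_onI, clarsimp simp: T_def \<beta>_def, goal_cases)
      case (1 i k r i' k' r')
      have "r = r' \<and> (M - 1 - k) * q + i = (M - 1 - k') * q + i'"
        by (rule two_digit_eqD[of r "M * q" "(M - 1 - k) * q + i" r' "(M - 1 - k') * q + i'"])
          (use 1 in \<open>auto intro: two_digit_less\<close>)
      then show ?case using two_digit_eqD[of "M - 1 - k" q i "M - 1 - k'" i'] 1 by auto
    qed
    have "\<beta> ` T \<subseteq> {..<N}"
    proof (clarsimp simp: T_def \<beta>_def)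
      fix i k r assume "i < q" "k < M" "r < p"
      then have "r * (M * q) + ((M - 1 - k) * q + i) < p * (M * q)" by (intro two_digit_less) auto
      then show "r * (M * q) + ((M - Suc k) * q + i) < N" by (simp add: N_def algebra_simps)
    qed
    then show "\<beta> ` T = {..<N}"
      by (intro card_subset_eq) (auto simp: card_image[OF inj] card)
  qed
  obtain s where s: "s permutes {..<N}" "\<And>x. x \<in> T \<Longrightarrow> s (\<alpha> x) = \<beta> x"
    using permutation_from_bijections[OF \<alpha> \<beta>] by blast
  \<comment> \<open>The last summand moves the left endpoint to the smallest value on the progression when
    \<open>\<theta>\<close> is negative.\<close>
  define c :: "nat \<times> nat \<Rightarrow> real" where "c = (\<lambda>(i, r). (1 - t) * (real i * M * p + r)
    + t * (real r * M * q + (real M - 1) * q + i) + min 0 (M * \<theta>))"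
  define F where "F = c ` ({..<q} \<times> {..<p})"
  define L where "L = M * \<bar>\<theta>\<bar> + 1"
  show thesis
  proof (rule that[of N s F L])
    have "2 \<le> M" "1 \<le> p * q" using M pq by (auto simp: Suc_le_eq)
    then have "1 * 2 \<le> p * q * M" by (intro mult_le_mono)
    then show "2 \<le> N" by (simp add: N_def)
    show "s permutes {..<N}" by fact
    show "finite F" by (simp add: F_def)
    show "0 \<le> L" by (simp add: L_def)
    have "card F \<le> q * p" unfolding F_def using card_image_le[of "{..<q} \<times> {..<p}" c] by simp
    then have "real (card F) * L \<le> real (q * p) * L" using \<open>0 \<le> L\<close> by (intro mult_right_mono) (auto simp del: of_nat_mult)
    also have "\<dots> = real N * (\<bar>\<theta>\<bar> + 1 / M)" using M by (simp add: N_def L_def field_simps)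
    also have "\<dots> \<le> real N * \<delta>" using pq M by (intro mult_left_mono) (auto simp: \<theta>_def)
    finally show "real (card F) * L \<le> \<delta> * N" by (simp add: mult.commute)
  next
    fix a assume "a < N"
    then have "a \<in> \<alpha> ` T" using \<alpha> by (auto simp: bij_betw_def)
    then obtain i k r where ikr: "i < q" "k < M" "r < p" "a = \<alpha> (i, k, r)"
      by (auto simp: T_def)
    have "s a = \<beta> (i, k, r)" using s(2)[of "(i, k, r)"] ikr by (auto simp: T_def)
    moreover have "real (M - 1 - k) = real M - 1 - real k" using ikr by (simp add: of_nat_diff)
    ultimately have sa: "real (s a) = r * (real M * q) + ((real M - 1 - k) * q + i)"
      by (simp only: \<beta>_def prod.case of_nat_add of_nat_mult)
    have "(1 - t) * real a + t * real (s a) = c (i, r) - min 0 (M * \<theta>) + k * \<theta>"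
      unfolding sa using ikr by (simp add: \<alpha>_def c_def \<theta>_def algebra_simps)
    moreover have "min 0 (M * \<theta>) \<le> k * \<theta> \<and> k * \<theta> \<le> min 0 (M * \<theta>) + M * \<bar>\<theta>\<bar>"
    proof (cases "\<theta> \<ge> 0")
      case True
      then have "k * \<theta> \<le> M * \<theta>" using ikr by (intro mult_right_mono) auto
      then show ?thesis using True by auto
    next
      case False
      then have "M * \<theta> \<le> k * \<theta>" "k * \<theta> \<le> 0" "M * \<theta> \<le> 0"
        using ikr by (auto intro: mult_right_mono_neg simp: mult_le_0_iff)
      then show ?thesis using False by auto
    qed
    ultimately have "c (i, r) \<le> (1 - t) * a + t * s a \<and> (1 - t) * a + t * s a + 1 \<le> c (i, r) + L"
      by (simp add: L_def)
    then show "\<exists>c\<in>F. c \<le> (1 - t) * a + t * s a \<and> (1 - t) * a + t * s a + 1 \<le> c + L"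
      using ikr by (auto simp: F_def)
  qed
qed

section \<open>Mixed radix expansions\<close>

text \<open>The reciprocal of \<open>place N n\<close> is the length of the cells obtained by fixing the first \<open>n\<close> digits.\<close>

definition place :: "(nat \<Rightarrow> nat) \<Rightarrow> nat \<Rightarrow> real" where
  "place N n = (\<Prod>i<n. real (N i))"

definition digit_seqs :: "(nat \<Rightarrow> nat) \<Rightarrow> (nat \<Rightarrow> nat) set" where
  "digit_seqs N = {d. \<forall>n. d n < N n}"

definition truncation :: "(nat \<Rightarrow> nat) \<Rightarrow> (nat \<Rightarrow> nat) \<Rightarrow> nat \<Rightarrow> real" where
  "truncation N d n = (\<Sum>i<n. d i / place N (Suc i))"

definition expansion :: "(nat \<Rightarrow> nat) \<Rightarrow> (nat \<Rightarrow> nat) \<Rightarrow> real" where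
  "expansion N d = (\<Sum>i. d i / place N (Suc i))"

text \<open>These are the analogues of the decimal expansions that end in nines.  Any two expansions
  of the same number differ because one of them is of this kind.\<close>

definition eventually_maximal :: "(nat \<Rightarrow> nat) \<Rightarrow> (nat \<Rightarrow> nat) set" where
  "eventually_maximal N = {d. \<exists>n. \<forall>i\<ge>n. Suc (d i) = N i}"

lemma place_Suc: "place N (Suc n) = place N n * N n"
  by (simp add: place_def)

lemma truncation_Suc: "truncation N d (Suc n) = truncation N d n + d n / place N (Suc n)"
  by (simp add: truncation_def)

context
  fixes N :: "nat \<Rightarrow> nat"
  assumes radix: "\<And>n. 2 \<le> N n"
begin

lemma radix_pos: "0 < N n"
  using radix[of n] by simp

lemma place_pos: "0 < place N n"
  by (simp add: place_def prod_pos radix_pos)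

lemma power2_le_place: "2 ^ n \<le> place N n"
proof (induction n)
  case (Suc n)
  have "(2::real) ^ n * 2 \<le> place N n * N n"
    using Suc radix[of n] by (intro mult_mono) (use place_pos[of n] in auto)
  then show ?case by (simp add: place_Suc mult.commute)
qed (simp add: place_def)

lemma inverse_place_tendsto_0: "(\<lambda>n. 1 / place N n) \<longlonglongrightarrow> 0"
proof (rule tendsto_sandwich[OF _ _ tendsto_const])
  show "\<forall>\<^sub>F n in sequentially. 0 \<le> 1 / place N n" using place_pos by (simp add: less_imp_le)
  show "\<forall>\<^sub>F n in sequentially. 1 / place N n \<le> (1 / 2) ^ n"
  proof (rule always_eventually, rule allI)
    fix n
    have "1 / place N n \<le> 1 / 2 ^ n" using power2_le_place[of n] place_pos[of n]
      by (intro divide_left_mono) auto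
    then show "1 / place N n \<le> (1 / 2) ^ n" by (simp add: power_divide)
  qed
  show "(\<lambda>n. (1 / 2 :: real) ^ n) \<longlonglongrightarrow> 0" by (rule LIMSEQ_realpow_zero) auto
qed

lemma cell_top_Suc_le:
  assumes "d n < N n"
  shows "truncation N d (Suc n) + 1 / place N (Suc n) \<le> truncation N d n + 1 / place N n"
proof -
  have "(real (d n) + 1) / place N (Suc n) \<le> N n / place N (Suc n)"
    using assms place_pos[of "Suc n"] by (intro divide_right_mono) auto
  also have "\<dots> = 1 / place N n" using radix_pos[of n] place_pos[of n] by (simp add: place_Suc)
  finally show ?thesis by (simp add: truncation_Suc add_divide_distrib)
qed

text \<open>A digit that is not maximal leaves room at the top of the cell; this is why two
  different expansions, each with infinitely many such digits, have different values.\<close>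

lemma cell_top_Suc_less:
  assumes "Suc (d n) < N n"
  shows "truncation N d (Suc n) + 1 / place N (Suc n) < truncation N d n + 1 / place N n"
proof -
  have "(real (d n) + 1) / place N (Suc n) < N n / place N (Suc n)"
    using assms place_pos[of "Suc n"] by (intro divide_strict_right_mono) auto
  also have "\<dots> = 1 / place N n" using radix_pos[of n] place_pos[of n] by (simp add: place_Suc)
  finally show ?thesis by (simp add: truncation_Suc add_divide_distrib)
qed

lemma cell_top_antimono:
  assumes "d \<in> digit_seqs N" "m \<le> n"
  shows "truncation N d n + 1 / place N n \<le> truncation N d m + 1 / place N m"
  using lift_Suc_antimono_le[of "\<lambda>n. truncation N d n + 1 / place N n", OF cell_top_Suc_le assms(2)]
    assms(1) by (auto simp: digit_seqs_def)

lemma summable_expansion: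
  assumes "d \<in> digit_seqs N"
  shows "summable (\<lambda>i. d i / place N (Suc i))"
proof (rule summableI_nonneg_bounded)
  show "0 \<le> d n / place N (Suc n)" for n using place_pos[of "Suc n"] by simp
  show "(\<Sum>i<n. d i / place N (Suc i)) \<le> 1" for n
  proof -
    have "truncation N d n + 1 / place N n \<le> 1"
      using cell_top_antimono[OF assms, of 0 n] by (simp add: truncation_def place_def)
    moreover have "0 < 1 / place N n" using place_pos[of n] by simp
    ultimately show ?thesis unfolding truncation_def by linarith
  qed
qed

lemma truncation_tendsto: "d \<in> digit_seqs N \<Longrightarrow> truncation N d \<longlonglongrightarrow> expansion N d"
  using summable_LIMSEQ[OF summable_expansion] unfolding truncation_def expansion_def by blast

lemma truncation_le_expansion:
  assumes "d \<in> digit_seqs N"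
  shows "truncation N d n \<le> expansion N d"
  unfolding truncation_def expansion_def
  by (rule sum_le_suminf[OF summable_expansion[OF assms]])
    (use place_pos in \<open>auto simp: less_imp_le\<close>)

lemma expansion_le_cell_top:
  assumes "d \<in> digit_seqs N"
  shows "expansion N d \<le> truncation N d n + 1 / place N n"
proof (rule LIMSEQ_le_const2[OF truncation_tendsto[OF assms]], intro exI allI impI)
  fix m assume "n \<le> m"
  then show "truncation N d m \<le> truncation N d n + 1 / place N n"
    using cell_top_antimono[OF assms, of n m] divide_pos_pos[of 1 "place N m"] place_pos[of m]
    by linarith
qed

lemma expansion_in_unit_interval: "d \<in> digit_seqs N \<Longrightarrow> expansion N d \<in> {0..1}"
  using truncation_le_expansion[of d 0] expansion_le_cell_top[of d 0]
  by (simp add: truncation_def place_def)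

text \<open>The cell of \<open>d\<close> after the first difference ends no later than that of \<open>e\<close> begins, and a later
  non-maximal digit of \<open>d\<close> keeps its expansion strictly below the end of its cell.\<close>

lemma expansion_strict_mono:
  assumes d: "d \<in> digit_seqs N" "d \<notin> eventually_maximal N" and e: "e \<in> digit_seqs N"
    and first: "\<And>i. i < n \<Longrightarrow> d i = e i" "d n < e n"
  shows "expansion N d < expansion N e"
proof -
  obtain m where m: "m \<ge> Suc n" "Suc (d m) \<noteq> N m"
    using d(2) by (auto simp: eventually_maximal_def)
  then have "Suc (d m) < N m" using d(1) by (auto simp: digit_seqs_def le_neq_implies_less Suc_leI)
  have eq: "truncation N d n = truncation N e n"
    unfolding truncation_def using first(1) by (intro sum.cong) auto
  have "expansion N d \<le> truncation N d (Suc m) + 1 / place N (Suc m)"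
    by (rule expansion_le_cell_top[OF d(1)])
  also have "\<dots> < truncation N d m + 1 / place N m"
    by (rule cell_top_Suc_less) fact
  also have "\<dots> \<le> truncation N d (Suc n) + 1 / place N (Suc n)"
    by (rule cell_top_antimono[OF d(1) m(1)])
  also have "\<dots> = truncation N e n + (real (d n) + 1) / place N (Suc n)"
    by (simp add: truncation_Suc eq add_divide_distrib)
  also have "\<dots> \<le> truncation N e (Suc n)"
    unfolding truncation_Suc using first(2) place_pos[of "Suc n"]
    by (intro add_left_mono divide_right_mono) auto
  also have "\<dots> \<le> expansion N e"
    by (rule truncation_le_expansion[OF e])
  finally show ?thesis .
qed

lemma inj_on_expansion: "inj_on (expansion N) (digit_seqs N - eventually_maximal N)"
proof (rule inj_onI, rule ccontr)
  fix d e assume d: "d \<in> digit_seqs N - eventually_maximal N" and e: "e \<in> digit_seqs N - eventually_maximal N"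
    and eq: "expansion N d = expansion N e" and "d \<noteq> e"
  then have ex: "\<exists>n. d n \<noteq> e n" by auto
  define n where "n = (LEAST n. d n \<noteq> e n)"
  have n: "d n \<noteq> e n" unfolding n_def by (rule LeastI_ex[OF ex])
  have below: "d i = e i" if "i < n" for i using not_less_Least[of i] that unfolding n_def by blast
  show False
  proof (cases "d n < e n")
    case True
    then show False using expansion_strict_mono[of d e n] d e eq below by auto
  next
    case False
    then show False using expansion_strict_mono[of e d n] d e eq below n by auto
  qed
qed

text \<open>The greedy algorithm, with each digit capped at its maximal value.  The cap takes effect only
  when the remainder is 1, and it makes the algorithm work for the right endpoint of the unit interval as well.\<close>

lemma expansion_surj: "expansion N ` digit_seqs N = {0..1}"
proof
  show "expansion N ` digit_seqs N \<subseteq> {0..1}" using expansion_in_unit_interval by blast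
  show "{0..1} \<subseteq> expansion N ` digit_seqs N"
  proof
    fix x :: real assume x: "x \<in> {0..1}"
    define digit where "digit r n = min (nat \<lfloor>N n * r\<rfloor>) (N n - 1)" for r :: real and n
    define rem where "rem = rec_nat x (\<lambda>n r. N n * r - digit r n)"
    define d where "d n = digit (rem n) n" for n
    have rem_0: "rem 0 = x" and rem_Suc: "rem (Suc n) = N n * rem n - d n" for n
      by (simp_all add: rem_def d_def)
    have rem: "rem n \<in> {0..1}" for n
    proof (induction n)
      case (Suc n)
      then have r: "0 \<le> N n * rem n" "N n * rem n \<le> N n" by (auto intro: mult_left_le)
      have "real (nat \<lfloor>N n * rem n\<rfloor>) = of_int \<lfloor>N n * rem n\<rfloor>" using r by simp
      then have fl: "real (nat \<lfloor>N n * rem n\<rfloor>) \<le> N n * rem n" "N n * rem n < real (nat \<lfloor>N n * rem n\<rfloor>) + 1"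
        by linarith+
      show ?case
      proof (cases "nat \<lfloor>N n * rem n\<rfloor> \<le> N n - 1")
        case True
        then have "d n = nat \<lfloor>N n * rem n\<rfloor>" by (simp add: d_def digit_def)
        then have "rem (Suc n) = N n * rem n - real (nat \<lfloor>N n * rem n\<rfloor>)" unfolding rem_Suc by simp
        then show ?thesis using fl unfolding atLeastAtMost_iff by linarith
      next
        case False
        then have "d n = N n - 1" by (simp add: d_def digit_def)
        moreover have "real (N n) \<le> real (nat \<lfloor>N n * rem n\<rfloor>)" using False by linarith
        moreover have "real (N n - 1) = real (N n) - 1" using radix_pos[of n] by simp
        ultimately show ?thesis using fl r unfolding rem_Suc atLeastAtMost_iff by linarith
      qed
    qed (use x rem_0 in simp)
    have d: "d \<in> digit_seqs N"
      using radix_pos by (auto simp: digit_seqs_def d_def digit_def min_less_iff_disj)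
    have x_eq: "x = truncation N d n + rem n / place N n" for n
    proof (induction n)
      case (Suc n)
      have "rem n / place N n = d n / place N (Suc n) + rem (Suc n) / place N (Suc n)"
        using place_pos[of n] radix_pos[of n] by (simp add: rem_Suc place_Suc field_simps)
      then show ?case using Suc by (simp add: truncation_Suc)
    qed (simp add: truncation_def place_def rem_0)
    have "truncation N d \<longlonglongrightarrow> x"
    proof (rule real_tendsto_sandwich)
      have b: "0 \<le> rem n / place N n" "rem n / place N n \<le> 1 / place N n" for n
        using rem[of n] place_pos[of n] by (auto intro: divide_right_mono)
      show "\<forall>\<^sub>F n in sequentially. x - 1 / place N n \<le> truncation N d n"
      proof (rule always_eventually, rule allI)
        fix n show "x - 1 / place N n \<le> truncation N d n" using x_eq[of n] b(2)[of n] by linarith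
      qed
      show "\<forall>\<^sub>F n in sequentially. truncation N d n \<le> x"
      proof (rule always_eventually, rule allI)
        fix n show "truncation N d n \<le> x" using x_eq[of n] b(1)[of n] by linarith
      qed
      show "(\<lambda>n. x - 1 / place N n) \<longlonglongrightarrow> x"
        using tendsto_diff[OF tendsto_const inverse_place_tendsto_0, of x] by simp
    qed simp
    then have "expansion N d = x"
      using truncation_tendsto[OF d] LIMSEQ_unique by blast
    then show "x \<in> expansion N ` digit_seqs N" using d by auto
  qed
qed

end

lemma countable_eventually_maximal: "countable (eventually_maximal N)"
proof -
  have "countable {d. \<forall>i\<ge>n. Suc (d i) = N i}" (is "countable ?A") for n
  proof (rule countableI'[of "\<lambda>d. map d [0..<n]"], rule inj_onI, rule ext)
    fix d e i assume de: "d \<in> ?A" "e \<in> ?A" "map d [0..<n] = map e [0..<n]"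
    show "d i = e i"
    proof (cases "i < n")
      case False
      then have "Suc (d i) = Suc (e i)" using de(1,2) by simp
      then show ?thesis by simp
    qed (use de(3) in auto)
  qed
  then have "countable (\<Union>n. {d. \<forall>i\<ge>n. Suc (d i) = N i})" by blast
  also have "(\<Union>n. {d. \<forall>i\<ge>n. Suc (d i) = N i}) = eventually_maximal N"
    by (auto simp: eventually_maximal_def)
  finally show ?thesis .
qed

section \<open>Bijections up to countable sets\<close>

text \<open>
  If \<open>u\<close> and \<open>v\<close> parametrize \<open>I\<close> injectively up to countable sets, then \<open>u d \<mapsto> v d\<close> is a bijection
  between the complements of two countable sets.  These need not have the same cardinality, so an
  infinite countable set of parameters is sacrificed first: then both exceptional
  sets are countably infinite and can be matched arbitrarily.
\<close>

lemma bijection_from_parametrizations: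
  fixes u v :: "'a \<Rightarrow> 'b"
  assumes I: "uncountable I" and u: "u ` \<Omega> = I" and v: "v ` \<Omega> = I"
    and B: "countable B" "inj_on u (\<Omega> - B)" and B': "countable B'" "inj_on v (\<Omega> - B')"
  obtains f C where "bij_betw f I I" "countable C" "\<And>x. x \<in> I - C \<Longrightarrow> \<exists>d\<in>\<Omega>. u d = x \<and> v d = f x"
proof -
  have "uncountable \<Omega>" using I u by blast
  then have "infinite (\<Omega> - (B \<union> B'))"
    using uncountable_minus_countable B B' countable_finite by (metis countable_Un)
  then obtain D where D: "D \<subseteq> \<Omega> - (B \<union> B')" "countable D" "infinite D"
    using infinite_countable_subset' by blast
  define \<Omega>' where "\<Omega>' = \<Omega> - (B \<union> B' \<union> D)"
  have rest: "countable (I - w ` \<Omega>') \<and> infinite (I - w ` \<Omega>')"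
    if "w ` \<Omega> = I" "inj_on w (\<Omega> - (B \<union> B'))" for w :: "'a \<Rightarrow> 'b"
  proof
    have "I - w ` \<Omega>' \<subseteq> w ` (B \<union> B' \<union> D)" using that(1) by (auto simp: \<Omega>'_def)
    then show "countable (I - w ` \<Omega>')"
      using B B' D by (meson countable_Un countable_image countable_subset)
    have "w ` D \<subseteq> I - w ` \<Omega>'"
      using that D(1) by (auto simp: \<Omega>'_def inj_on_def)
    moreover have "inj_on w D" using that(2) D(1) by (rule inj_on_subset)
    then have "infinite (w ` D)" using D(3) finite_image_iff by blast
    ultimately show "infinite (I - w ` \<Omega>')" using finite_subset by blast
  qed
  have inj: "inj_on u (\<Omega> - (B \<union> B'))" "inj_on v (\<Omega> - (B \<union> B'))"
    using B B' by (auto intro: inj_on_subset)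
  then have inj': "inj_on u \<Omega>'" "inj_on v \<Omega>'"
    by (auto simp: \<Omega>'_def intro: inj_on_subset)
  obtain g h where g: "bij_betw g (UNIV :: nat set) (I - u ` \<Omega>')"
    and h: "bij_betw h (UNIV :: nat set) (I - v ` \<Omega>')"
    using rest[OF u inj(1)] rest[OF v inj(2)] by (meson countable_infiniteE')
  define f where "f x = (if x \<in> u ` \<Omega>' then (v \<circ> inv_into \<Omega>' u) x else (h \<circ> inv_into UNIV g) x)" for x
  have "bij_betw (v \<circ> inv_into \<Omega>' u) (u ` \<Omega>') (v ` \<Omega>')"
    using inj' by (meson bij_betw_inv_into bij_betw_trans inj_on_imp_bij_betw)
  moreover have "bij_betw (h \<circ> inv_into UNIV g) (I - u ` \<Omega>') (I - v ` \<Omega>')"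
    using g h by (meson bij_betw_inv_into bij_betw_trans)
  ultimately have "bij_betw f (u ` \<Omega>' \<union> (I - u ` \<Omega>')) (v ` \<Omega>' \<union> (I - v ` \<Omega>'))"
    unfolding f_def by (rule bij_betw_disjoint_Un) auto
  moreover have "u ` \<Omega>' \<union> (I - u ` \<Omega>') = I" "v ` \<Omega>' \<union> (I - v ` \<Omega>') = I"
    using u v by (auto simp: \<Omega>'_def)
  ultimately have "bij_betw f I I" by simp
  moreover have "countable (I - u ` \<Omega>')" using rest[OF u inj(1)] by blast
  moreover have "\<exists>d\<in>\<Omega>. u d = x \<and> v d = f x" if "x \<in> I - (I - u ` \<Omega>')" for x
  proof -
    have "x \<in> u ` \<Omega>'" using that by blast
    then obtain d where "d \<in> \<Omega>'" "u d = x" by blast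
    then have "inv_into \<Omega>' u x = d" using inj'(1) by auto
    then have "f x = v d" using \<open>x \<in> u ` \<Omega>'\<close> by (simp add: f_def)
    then show ?thesis using \<open>d \<in> \<Omega>'\<close> \<open>u d = x\<close> by (auto simp: \<Omega>'_def)
  qed
  ultimately show thesis by (rule that)
qed

section \<open>Null sets in the plane\<close>

text \<open>Fubini's theorem.  The exceptional heights matter because the slices at heights 0 and 1 of the
  union of the segments are full unit intervals.\<close>

lemma null_sets_lborel_if_horizontal_slices_null:
  fixes K :: "(real \<times> real) set"
  assumes "closed K" and slice: "\<And>t. t \<notin> Z \<Longrightarrow> emeasure lborel {z. (z, t) \<in> K} = 0" and "countable Z"
  shows "K \<in> null_sets lborel"
proof -
  have K: "K \<in> sets (lborel \<Otimes>\<^sub>M lborel)"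
    using assms(1) by (simp only: lborel_prod) simp
  have "emeasure (lborel \<Otimes>\<^sub>M lborel) K = (\<integral>\<^sup>+t. emeasure lborel ((\<lambda>z. (z, t)) -` K) \<partial>lborel)"
    by (rule lborel_pair.emeasure_pair_measure_alt2[OF K])
  also have "\<dots> = (\<integral>\<^sup>+t. 0 \<partial>(lborel :: real measure))"
  proof (rule nn_integral_cong_AE, rule AE_I')
    show "Z \<in> null_sets lborel" using assms(3) by (rule countable_imp_null_set_lborel)
    show "{t \<in> space lborel. emeasure lborel ((\<lambda>z. (z, t)) -` K) \<noteq> 0} \<subseteq> Z"
      using slice by (auto simp: vimage_def)
  qed
  finally show ?thesis using assms(1) by (simp add: lborel_prod null_sets_def)
qed

lemma segment_null:
  fixes a b :: real
  shows "(\<lambda>t. ((1 - t) * a + t * b, t)) ` {0..1} \<in> null_sets lborel"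
proof (rule null_sets_lborel_if_horizontal_slices_null[where Z = "{}"])
  show "closed ((\<lambda>t. ((1 - t) * a + t * b, t)) ` {0..1})"
    by (intro compact_imp_closed compact_continuous_image continuous_intros) auto
  fix t
  have "{z. (z, t) \<in> (\<lambda>t. ((1 - t) * a + t * b, t)) ` {0..1}} \<subseteq> {(1 - t) * a + t * b}" by auto
  then have "countable {z. (z, t) \<in> (\<lambda>t. ((1 - t) * a + t * b, t)) ` {0..1}}"
    by (rule countable_subset) simp
  then show "emeasure lborel {z. (z, t) \<in> (\<lambda>t. ((1 - t) * a + t * b, t)) ` {0..1}} = 0"
    by (rule emeasure_lborel_countable)
qed simp

lemma emeasure_Union_intervals_le:
  fixes g :: "'a \<Rightarrow> real"
  assumes "finite J" "0 \<le> (l::real)" "A \<subseteq> (\<Union>j\<in>J. {g j..g j + l})"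
  shows "emeasure lborel A \<le> ennreal (real (card J) * l)"
proof -
  have "emeasure lborel A \<le> emeasure lborel (\<Union>j\<in>J. {g j..g j + l})"
    using assms by (intro emeasure_mono) auto
  also have "\<dots> \<le> (\<Sum>j\<in>J. emeasure lborel {g j..g j + l})"
    using assms by (intro emeasure_subadditive_finite) auto
  also have "\<dots> = ennreal (real (card J) * l)"
    using assms(2) by (simp add: ennreal_mult ennreal_of_nat_eq_real_of_nat)
  finally show ?thesis .
qed

section \<open>The union of the segments\<close>

text \<open>A corner is a pair of truncations to the first \<open>n\<close> digits: one of a point at the bottom, one of its
  image at the top.  The associated strip joins the two cells that have these as left endpoints.\<close>

primrec corners :: "(nat \<Rightarrow> nat) \<Rightarrow> (nat \<Rightarrow> nat \<Rightarrow> nat) \<Rightarrow> nat \<Rightarrow> (real \<times> real) set" where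
  "corners N s 0 = {(0, 0)}"
| "corners N s (Suc n) = (\<lambda>((x, y), a). (x + a / place N (Suc n), y + s n a / place N (Suc n)))
     ` (corners N s n \<times> {..<N n})"

definition strips :: "(nat \<Rightarrow> nat) \<Rightarrow> (nat \<Rightarrow> nat \<Rightarrow> nat) \<Rightarrow> nat \<Rightarrow> (real \<times> real) set" where
  "strips N s n = (\<Union>(x, y)\<in>corners N s n.
     {(z, t). (1 - t) * x + t * y \<le> z \<and> z \<le> (1 - t) * x + t * y + 1 / place N n})"

lemma finite_corners: "finite (corners N s n)"
  by (induction n) auto

lemma card_corners_le: "card (corners N s n) \<le> place N n"
proof (induction n)
  case (Suc n)
  have "real (card (corners N s (Suc n))) \<le> card (corners N s n \<times> {..<N n})"
    unfolding corners.simps by (intro of_nat_mono card_image_le) (simp add: finite_corners)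
  also have "\<dots> = card (corners N s n) * real (N n)" by (simp add: card_cartesian_product)
  also have "\<dots> \<le> place N (Suc n)" unfolding place_Suc using Suc by (intro mult_right_mono) auto
  finally show ?case .
qed (simp add: place_def)

lemma closed_strips: "closed (strips N s n)"
proof -
  have "closed {(z, t). (1 - t) * x + t * y \<le> z \<and> z \<le> (1 - t) * x + t * y + 1 / place N n}" for x y
    unfolding case_prod_unfold by (intro closed_Collect_conj closed_Collect_le continuous_intros)
  then show ?thesis
    unfolding strips_def by (intro closed_UN finite_corners) auto
qed

lemma truncations_in_corners:
  assumes "d \<in> digit_seqs N"
  shows "(truncation N d n, truncation N (\<lambda>i. s i (d i)) n) \<in> corners N s n"
proof (induction n)
  case (Suc n)
  then show ?case using assms
    by (force simp: truncation_Suc digit_seqs_def intro!: rev_image_eqI)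
qed (simp add: truncation_def)

text \<open>At heights in the unit interval, the segment is a convex combination of two points, each
  in the cell above its truncation, so it stays in the strip of these two cells.\<close>

lemma segment_in_strips:
  assumes N: "\<And>n. 2 \<le> N n" and d: "d \<in> digit_seqs N" and e: "(\<lambda>i. s i (d i)) \<in> digit_seqs N"
    and t: "t \<in> {0..1}"
  shows "((1 - t) * expansion N d + t * expansion N (\<lambda>i. s i (d i)), t) \<in> strips N s n"
proof -
  let ?e = "\<lambda>i. s i (d i)"
  have "(1 - t) * truncation N d n \<le> (1 - t) * expansion N d"
    "t * truncation N ?e n \<le> t * expansion N ?e"
    using t truncation_le_expansion[of N, OF N d] truncation_le_expansion[of N, OF N e]
    by (auto intro: mult_left_mono)
  moreover have "(1 - t) * expansion N d \<le> (1 - t) * (truncation N d n + 1 / place N n)"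
    "t * expansion N ?e \<le> t * (truncation N ?e n + 1 / place N n)"
    using t expansion_le_cell_top[of N, OF N d, of n] expansion_le_cell_top[of N, OF N e, of n]
    by (auto intro!: mult_left_mono)
  then have "(1 - t) * expansion N d + t * expansion N ?e
      \<le> (1 - t) * truncation N d n + t * truncation N ?e n + 1 / place N n"
    by (simp add: algebra_simps diff_divide_distrib)
  ultimately show ?thesis
    unfolding strips_def
    by (intro UN_I[OF truncations_in_corners[OF d, of n s]]) simp
qed

text \<open>
  Over each corner of level \<open>n\<close>, the slice of level \<open>n + 1\<close> is a copy of the \<open>N n\<close> unit intervals scaled by
  \<open>1 / place N (Suc n)\<close>.  It is covered by \<open>card F\<close> intervals of total length at most
  \<open>\<delta> N n / place N (Suc n) = \<delta> / place N n\<close>, and there are at most \<open>place N n\<close> corners.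
\<close>

lemma slice_strips_le:
  fixes N :: "nat \<Rightarrow> nat" and s :: "nat \<Rightarrow> nat \<Rightarrow> nat" and t \<delta> L :: real
  assumes N: "\<And>n. 2 \<le> N n" and "finite F" "0 \<le> L" "real (card F) * L \<le> \<delta> * N n"
    and cover: "\<And>a. a < N n \<Longrightarrow>
      \<exists>c\<in>F. c \<le> (1 - t) * a + t * s n a \<and> (1 - t) * a + t * s n a + 1 \<le> c + L"
  shows "emeasure lborel {z. (z, t) \<in> strips N s (Suc n)} \<le> ennreal \<delta>"
proof -
  let ?P = "place N (Suc n)"
  have P: "0 < ?P" by (rule place_pos[of N, OF N])
  define g where "g = (\<lambda>((x, y), c). (1 - t) * x + t * y + c / ?P)"
  have "{z. (z, t) \<in> strips N s (Suc n)} \<subseteq> (\<Union>j\<in>corners N s n \<times> F. {g j..g j + L / ?P})"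
  proof
    fix z assume "z \<in> {z. (z, t) \<in> strips N s (Suc n)}"
    then obtain x y a where xya: "(x, y) \<in> corners N s n" "a < N n"
      "(1 - t) * (x + a / ?P) + t * (y + s n a / ?P) \<le> z"
      "z \<le> (1 - t) * (x + a / ?P) + t * (y + s n a / ?P) + 1 / ?P"
      by (auto simp: strips_def)
    obtain c where c: "c \<in> F" "c \<le> (1 - t) * a + t * s n a" "(1 - t) * a + t * s n a + 1 \<le> c + L"
      using cover[OF xya(2)] by blast
    have "c / ?P \<le> ((1 - t) * a + t * s n a) / ?P"
      "((1 - t) * a + t * s n a + 1) / ?P \<le> (c + L) / ?P"
      using c P by (auto intro: divide_right_mono)
    then have "z \<in> {g ((x, y), c)..g ((x, y), c) + L / ?P}"
      using xya by (simp add: g_def algebra_simps add_divide_distrib diff_divide_distrib)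
    then show "z \<in> (\<Union>j\<in>corners N s n \<times> F. {g j..g j + L / ?P})" using xya c by blast
  qed
  then have "emeasure lborel {z. (z, t) \<in> strips N s (Suc n)}
      \<le> ennreal (card (corners N s n \<times> F) * (L / ?P))"
    using assms P by (intro emeasure_Union_intervals_le) (auto simp: finite_corners)
  also have "card (corners N s n \<times> F) * (L / ?P) \<le> \<delta>"
  proof -
    have "0 < place N n" by (rule place_pos[of N, OF N])
    then have "card (corners N s n) * (card F * L) \<le> place N n * (\<delta> * N n)"
      using card_corners_le[of N s n] assms(3,4)
      by (intro mult_mono[OF _ \<open>card F * L \<le> \<delta> * N n\<close>]) simp_all
    then show ?thesis using P by (simp add: place_Suc card_cartesian_product field_simps)
  qed
  finally show ?thesis by (simp add: ennreal_leI)
qed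

lemma enumeration_of_finite_permutations:
  obtains N :: "nat \<Rightarrow> nat" and s where "\<And>n. 2 \<le> N n" "\<And>n. s n permutes {..<N n}"
    "\<And>m p. 2 \<le> m \<Longrightarrow> p permutes {..<m} \<Longrightarrow> \<exists>n. N n = m \<and> s n = p"
proof -
  define X where "X = (SIGMA m:{2::nat..}. {p. p permutes {..<m}})"
  have "countable X"
    unfolding X_def by (intro countable_SIGMA countableI_type countable_finite finite_permutations) auto
  moreover have "X \<noteq> {}" unfolding X_def using permutes_id by blast
  ultimately have r: "range (from_nat_into X) = X" by simp
  show thesis
  proof (rule that[of "fst \<circ> from_nat_into X" "snd \<circ> from_nat_into X"])
    have "from_nat_into X n \<in> X" for n using r by blast
    then show "2 \<le> (fst \<circ> from_nat_into X) n"
      "(snd \<circ> from_nat_into X) n permutes {..<(fst \<circ> from_nat_into X) n}" for n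
      by (auto simp: X_def split_beta dest!: meta_spec[of _ n])
    fix m :: nat and p assume "2 \<le> m" "p permutes {..<m}"
    then have "(m, p) \<in> range (from_nat_into X)" unfolding r by (simp add: X_def)
    then show "\<exists>n. (fst \<circ> from_nat_into X) n = m \<and> (snd \<circ> from_nat_into X) n = p"
      by (metis comp_apply fst_conv rangeE snd_conv)
  qed
qed

theorem proposition1:
  "\<exists>f :: real \<Rightarrow> real. bij_betw f {0..1} {0..1} \<and>
     (\<Union>t\<in>{0..1}. \<Union>x\<in>{0..1}. {((1 - t) * x + t * f x, t)}) \<in> null_sets (lebesgue :: (real \<times> real) measure)"
proof -
  obtain N :: "nat \<Rightarrow> nat" and s where N: "\<And>n. 2 \<le> N n" and s: "\<And>n. s n permutes {..<N n}"
    and all: "\<And>m p. 2 \<le> m \<Longrightarrow> p permutes {..<m} \<Longrightarrow> \<exists>n. N n = m \<and> s n = p"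
    by (rule enumeration_of_finite_permutations) (rule that)
  define \<Phi> where "\<Phi> d = (\<lambda>i. s i (d i))" for d
  have s_less: "s i a < N i \<longleftrightarrow> a < N i" "inv (s i) a < N i \<longleftrightarrow> a < N i" for i a
    using permutes_in_image[OF s[of i], of a] permutes_in_image[OF permutes_inv[OF s[of i]], of a]
    by (simp_all only: lessThan_iff)
  have \<Phi>: "bij_betw \<Phi> (digit_seqs N) (digit_seqs N)"
  proof (rule bij_betw_byWitness[where f' = "\<lambda>d i. inv (s i) (d i)"])
    show "\<forall>d\<in>digit_seqs N. (\<lambda>i. inv (s i) (\<Phi> d i)) = d"
      "\<forall>d\<in>digit_seqs N. \<Phi> (\<lambda>i. inv (s i) (d i)) = d"
      by (auto simp: \<Phi>_def permutes_inverses[OF s])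
    show "\<Phi> ` digit_seqs N \<subseteq> digit_seqs N"
      by (auto simp: \<Phi>_def digit_seqs_def s_less)
    show "(\<lambda>d i. inv (s i) (d i)) ` digit_seqs N \<subseteq> digit_seqs N"
      by (auto simp: digit_seqs_def s_less)
  qed
  \<comment> \<open>Outside \<open>B\<close>, the value of the permuted expansion determines the digits.\<close>
  define B where "B = {d \<in> digit_seqs N. \<Phi> d \<in> eventually_maximal N}"
  have "\<Phi> ` B \<subseteq> eventually_maximal N" by (auto simp: B_def)
  then have "countable (\<Phi> ` B)" using countable_eventually_maximal countable_subset by blast
  moreover have "inj_on \<Phi> B" using \<Phi> by (auto simp: B_def bij_betw_def intro: inj_on_subset)
  ultimately have B: "countable B" by (rule countable_image_inj_on)
  have "inj_on (expansion N \<circ> \<Phi>) (digit_seqs N - B)"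
  proof (rule comp_inj_on)
    show "inj_on \<Phi> (digit_seqs N - B)" using \<Phi> by (auto simp: bij_betw_def intro: inj_on_subset)
    show "inj_on (expansion N) (\<Phi> ` (digit_seqs N - B))"
      using inj_on_expansion[of N, OF N] by (rule inj_on_subset) (use bij_betwE[OF \<Phi>] in \<open>auto simp: B_def\<close>)
  qed
  moreover have "(expansion N \<circ> \<Phi>) ` digit_seqs N = {0..1}"
    using \<Phi> expansion_surj[of N, OF N] by (simp only: image_comp[symmetric] bij_betw_def)
  moreover have "uncountable {0..1::real}" by (simp add: uncountable_closed_interval)
  ultimately obtain f C where f: "bij_betw f {0..1} {0..1 :: real}" and C: "countable C"
    and fd: "\<And>x. x \<in> {0..1} - C \<Longrightarrow> \<exists>d\<in>digit_seqs N. expansion N d = x \<and> (expansion N \<circ> \<Phi>) d = f x"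
    using bijection_from_parametrizations[OF _ expansion_surj[of N, OF N] _
        countable_eventually_maximal inj_on_expansion[of N, OF N] B, of "expansion N \<circ> \<Phi>"]
    by metis

  \<comment> \<open>Outside the horizontal band, \<open>(1 - t) x + t (f x)\<close> is no convex combination and the slices of
    the strips need not be small, so the band is cut out explicitly.\<close>
  define K where "K = (\<Inter>n. strips N s n) \<inter> UNIV \<times> {0..1}"
  have "K \<in> null_sets lborel"
  proof (rule null_sets_lborel_if_horizontal_slices_null[where Z = "{0, 1}"])
    show "closed K" unfolding K_def by (intro closed_Int closed_INT closed_Times closed_strips ballI) auto
    fix t :: real assume t: "t \<notin> {0, 1}"
    show "emeasure lborel {z. (z, t) \<in> K} = 0"
    proof (cases "0 < t \<and> t < 1")
      case True
      have "emeasure lborel {z. (z, t) \<in> K} \<le> 0 + ennreal \<delta>" if \<delta>: "0 < \<delta>" for \<delta>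
      proof -
        obtain m :: nat and p F L where mp: "2 \<le> m" "p permutes {..<m}" "finite F" "0 \<le> L" "real (card F) * L \<le> \<delta> * m"
          and cover: "\<And>a. a < m \<Longrightarrow> \<exists>c\<in>F. c \<le> (1 - t) * a + t * p a \<and> (1 - t) * a + t * p a + 1 \<le> c + L"
          by (rule compressing_permutation[OF conjunct1[OF True] conjunct2[OF True] \<delta>]) (rule that)
        obtain n where n: "N n = m" "s n = p" using all[OF mp(1,2)] by blast
        have "closed {z. (z, t) \<in> strips N s (Suc n)}"
          using continuous_closed_vimage[OF closed_strips, of "\<lambda>z. (z, t)"]
          by (auto simp: vimage_def intro!: continuous_intros)
        then have "emeasure lborel {z. (z, t) \<in> K} \<le> emeasure lborel {z. (z, t) \<in> strips N s (Suc n)}"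
          by (intro emeasure_mono) (auto simp: K_def)
        also have "\<dots> \<le> ennreal \<delta>"
          by (rule slice_strips_le[of N, OF N mp(3,4)]) (use mp(5) cover n in auto)
        finally show ?thesis by simp
      qed
      then have "emeasure lborel {z. (z, t) \<in> K} \<le> 0" by (rule ennreal_le_epsilon)
      then show ?thesis by simp
    next
      case False
      then have "{z. (z, t) \<in> K} = {}" using t by (auto simp: K_def)
      then show ?thesis by simp
    qed
  qed simp
  moreover have "(\<Union>x\<in>C. (\<lambda>t. ((1 - t) * x + t * f x, t)) ` {0..1}) \<in> null_sets lborel"
    using C segment_null by (intro null_sets_UN') auto
  ultimately have null: "K \<union> (\<Union>x\<in>C. (\<lambda>t. ((1 - t) * x + t * f x, t)) ` {0..1}) \<in> null_sets lborel"
    by (rule null_sets.Un)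
  have "(\<Union>t\<in>{0..1}. \<Union>x\<in>{0..1}. {((1 - t) * x + t * f x, t)})
      \<subseteq> K \<union> (\<Union>x\<in>C. (\<lambda>t. ((1 - t) * x + t * f x, t)) ` {0..1})"
  proof clarify
    fix t x :: real
    assume t: "t \<in> {0..1}" and x: "x \<in> {0..1}"
      and notin: "((1 - t) * x + t * f x, t) \<notin> (\<Union>x\<in>C. (\<lambda>t. ((1 - t) * x + t * f x, t)) ` {0..1})"
    then have "x \<notin> C" by blast
    then obtain d where d: "d \<in> digit_seqs N" "expansion N d = x" "expansion N (\<Phi> d) = f x"
      using fd[of x] x by auto
    have "\<Phi> d \<in> digit_seqs N" using bij_betwE[OF \<Phi>] d(1) by blast
    then show "((1 - t) * x + t * f x, t) \<in> K"
      using segment_in_strips[of N, OF N d(1), of s t] t d by (auto simp: K_def \<Phi>_def)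
  qed
  then have "(\<Union>t\<in>{0..1}. \<Union>x\<in>{0..1}. {((1 - t) * x + t * f x, t)}) \<in> null_sets lebesgue"
    using null by (rule null_sets_completion_subset[OF _ null_sets_completionI])
  with f show ?thesis by blast
qed

end
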